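(* Let $n\ge2$. Let $\tau$ be the strong stationary time for the random-to-below shuffle on $n$ cards given by the first time at which a bookmark initially placed right above the bottom card of the deck reaches the top of the deck (see context). Then the expected number of steps is $$\mathbb{E}(\tau)=\sum_{i=2}^n\frac{n}{i\,(H_n-H_{i-1})}.$$ Moreover, $$\sum_{i=2}^n\frac{n}{i\,(H_n-H_{i-1})}\le n\log n+n\log(\log n)+n\log 2+1,$$ where $\log$ denotes the natural logarithm.
   Context: $H_i:=\sum_{k=1}^i\frac1k$ is the $i$-th harmonic number. Random-to-below shuffle on a deck of $n$ cards: at each step $t\ge1$, independently of the past, a position $I_t\in\{1,\ldots,n\}$ (counted from the top) is chosen uniformly at random, then $J_t$ is chosen uniformly from $\{I_t,I_t+1,\ldots,n\}$, and the card at position $I_t$ is removed and reinserted so that it ends up at position $J_t$. Bookmark: a bookmark (not a card) is initially placed right above the bottom card. It moves only when a card above it is inserted below it; a card inserted into the space containing the bookmark is placed below the bookmark. If $b_t$ denotes the number of cards above the bookmark at time $t$, then $b_0=n-1$, and $b_t=b_{t-1}-1$ if $I_t\le b_{t-1}\le J_t$, while $b_t=b_{t-1}$ otherwise. The time $\tau$ is the first $t\ge0$ with $b_t=0$. *)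

theory Defs
  imports "HOL-Probability.Probability"
begin

definition insert_at :: "nat \<Rightarrow> 'c \<Rightarrow> 'c list \<Rightarrow> 'c list" where
  "insert_at k x xs = take k xs @ x # drop k xs"

definition remove_at :: "nat \<Rightarrow> 'c list \<Rightarrow> 'c list" where
  "remove_at k xs = take k xs @ drop (Suc k) xs"

text \<open>
  A deck is listed from top to bottom. Positions are counted from 1, list indices from 0.
\<close>

definition move_card :: "nat \<Rightarrow> nat \<Rightarrow> 'c list \<Rightarrow> 'c list" where
  "move_card i j d = insert_at (j - 1) (d ! (i - 1)) (remove_at (i - 1) d)"

definition below_choice_pmf :: "nat \<Rightarrow> (nat \<times> nat) pmf" where
  "below_choice_pmf n =
     bind_pmf (pmf_of_set {1..n}) (\<lambda>i. map_pmf (Pair i) (pmf_of_set {i..n}))"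

text \<open>
  A bookmarked deck is a pair of lists: the cards above the bookmark and the cards below it.
  The moved card ends up at position j when j - 1 of the remaining cards precede it. If exactly
  j - 1 cards remain above the bookmark, it enters the space containing the bookmark and goes
  below the bookmark.
\<close>

definition bookmark_step :: "nat \<Rightarrow> nat \<Rightarrow> 'c list \<times> 'c list \<Rightarrow> 'c list \<times> 'c list" where
  "bookmark_step i j = (\<lambda>(us, vs).
     let c = (us @ vs) ! (i - 1);
         (us', vs') = (if i \<le> length us then (remove_at (i - 1) us, vs)
                       else (us, remove_at (i - 1 - length us) vs))
     in if j - 1 < length us' then (insert_at (j - 1) c us', vs')
        else (us', insert_at (j - 1 - length us') c vs'))"

primrec bookmarked_deck ::
  "(nat \<Rightarrow> nat) \<Rightarrow> (nat \<Rightarrow> nat) \<Rightarrow> 'c list \<Rightarrow> nat \<Rightarrow> 'c list \<times> 'c list" where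
  "bookmarked_deck I J d 0 = (butlast d, [last d])"
| "bookmarked_deck I J d (Suc t) = bookmark_step (I (Suc t)) (J (Suc t)) (bookmarked_deck I J d t)"

definition cards_above_bookmark :: "(nat \<Rightarrow> nat) \<Rightarrow> (nat \<Rightarrow> nat) \<Rightarrow> 'c list \<Rightarrow> nat \<Rightarrow> nat" where
  "cards_above_bookmark I J d t = length (fst (bookmarked_deck I J d t))"

text \<open>The value is \<open>\<infinity>\<close> if the bookmark never reaches the top of the deck.\<close>

definition bookmark_time :: "(nat \<Rightarrow> nat) \<Rightarrow> (nat \<Rightarrow> nat) \<Rightarrow> 'c list \<Rightarrow> enat" where
  "bookmark_time I J d = (INF t\<in>{t. cards_above_bookmark I J d t = 0}. enat t)"

lemma length_insert_at [simp]: "length (insert_at k x xs) = Suc (length xs)"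
  by (simp add: insert_at_def)

lemma length_remove_at: "k < length xs \<Longrightarrow> length (remove_at k xs) = length xs - 1"
  by (auto simp: remove_at_def)

lemma insert_at_append:
  "insert_at k x (us @ vs) =
     (if k < length us then insert_at k x us @ vs else us @ insert_at (k - length us) x vs)"
  by (simp add: insert_at_def)

lemma remove_at_append:
  "remove_at k (us @ vs) =
     (if k < length us then remove_at k us @ vs else us @ remove_at (k - length us) vs)"
  by (simp add: remove_at_def Suc_diff_le)

text \<open>Forgetting the bookmark gives the plain shuffle step.\<close>

lemma bookmark_step_move_card:
  assumes "1 \<le> i"
  shows "fst (bookmark_step i j p) @ snd (bookmark_step i j p) = move_card i j (fst p @ snd p)"
proof -
  have "(i - 1 < length (fst p)) = (i \<le> length (fst p))"
    using assms by auto
  then show ?thesis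
    by (auto simp: bookmark_step_def move_card_def Let_def split_beta remove_at_append insert_at_append)
qed

lemma length_fst_bookmark_step:
  assumes "1 \<le> i" "i \<le> j" "j \<le> length us + length vs"
  shows "length (fst (bookmark_step i j (us, vs))) =
           (if i \<le> length us \<and> length us \<le> j then length us - 1 else length us)"
  using assms by (auto simp: bookmark_step_def Let_def length_remove_at)

lemma cards_above_bookmark_0: "cards_above_bookmark I J d 0 = length d - 1"
  by (simp add: cards_above_bookmark_def)

lemma length_bookmarked_deck:
  assumes "d \<noteq> []" "\<And>s. s \<in> {1..t} \<Longrightarrow> 1 \<le> I s \<and> I s \<le> J s \<and> J s \<le> length d"
  shows "length (fst (bookmarked_deck I J d t)) + length (snd (bookmarked_deck I J d t)) = length d"
  using assms
proof (induction t)
  case 0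
  then show ?case by (cases d) auto
next
  case (Suc t)
  define p where "p = bookmarked_deck I J d t"
  have len: "length (fst p @ snd p) = length d"
    using Suc by (simp add: p_def)
  have IJ: "1 \<le> I (Suc t)" "I (Suc t) \<le> J (Suc t)" "J (Suc t) \<le> length d"
    using Suc.prems(2)[of "Suc t"] by auto
  have "length (move_card (I (Suc t)) (J (Suc t)) (fst p @ snd p)) = length d"
    using len IJ by (simp add: move_card_def length_remove_at)
  then have "length (fst (bookmark_step (I (Suc t)) (J (Suc t)) p) @
                     snd (bookmark_step (I (Suc t)) (J (Suc t)) p)) = length d"
    using bookmark_step_move_card[OF IJ(1)] by metis
  then show ?case
    by (simp add: p_def)
qed

lemma cards_above_bookmark_Suc:
  fixes I J :: "nat \<Rightarrow> nat" and d :: "'c list" and t :: nat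
  defines "b \<equiv> cards_above_bookmark I J d"
  assumes "d \<noteq> []" "\<And>s. s \<in> {1..Suc t} \<Longrightarrow> 1 \<le> I s \<and> I s \<le> J s \<and> J s \<le> length d"
  shows "b (Suc t) = (if I (Suc t) \<le> b t \<and> b t \<le> J (Suc t) then b t - 1 else b t)"
proof -
  obtain us vs where p: "bookmarked_deck I J d t = (us, vs)"
    by fastforce
  have "length us + length vs = length d"
    using length_bookmarked_deck[of d t I J] assms(2,3) p by simp
  then show ?thesis
    using assms(3)[of "Suc t"] length_fst_bookmark_step[of "I (Suc t)" "J (Suc t)" us vs] p
    by (simp add: b_def cards_above_bookmark_def)
qed

end

theory Submission
  imports Defs
begin

text \<open>
  The bookmark height \<open>b\<close> is a Markov chain that starts at \<open>n - 1\<close> and can only descend, one level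
  at a time. From level \<open>k \<ge> 1\<close> it descends when \<open>I \<le> k \<le> J\<close>, which has probability
  \<open>p k = (n + 1 - k) (H n - H (n - k)) / n\<close> (\<open>prob_below_choice_crosses\<close>). So level \<open>k\<close> is occupied
  for \<open>1 / p k\<close> steps on average, and the mean time to reach \<open>0\<close> is the sum of these numbers over
  \<open>k = 1, \<dots>, n - 1\<close> (\<open>nn_integral_descent_time\<close>); the substitution \<open>i = n + 1 - k\<close> gives the stated
  sum. The mean occupation time comes from a flux balance rather than from geometric distributions:
  the decrease of \<open>P (b t \<ge> k)\<close> in one step is \<open>p k P (b t = k)\<close>, and summing over \<open>t\<close> telescopes.
  Independence gives this rate: \<open>b t\<close>, a function of the first \<open>t\<close> choices, is independent of
  choice \<open>t + 1\<close> (\<open>bookmark_height_rate\<close>).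

  For the upper bound, put \<open>a i = H n - H (i - 1)\<close>, so that \<open>a i - a (i + 1) = 1 / i\<close>. The function
  \<open>1 / x\<close> is convex, so its mean over the interval of length \<open>1 / i\<close> centred at \<open>a i\<close> is at least
  \<open>1 / a i\<close>; hence \<open>1 / (i a i) \<le> ln (a i + 1 / (2 i)) - ln (a i - 1 / (2 i))\<close>. These intervals are
  disjoint, since the one for \<open>i\<close> reaches up to \<open>a i + 1 / (2 i)\<close> and the one for \<open>i - 1\<close> starts at
  \<open>a i + 1 / (2 (i - 1))\<close>. So the sum of \<open>1 / (i a i)\<close> over \<open>i = 2, \<dots>, n\<close> is at most
  \<open>ln (H n - 3 / 4) - ln (1 / (2 n))\<close>. For \<open>n \<ge> 3\<close> we have \<open>H n - 3 / 4 \<le> ln n\<close>, and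
  the bound follows; the case \<open>n = 2\<close>, where \<open>H 2 - 3 / 4 > ln 2\<close>, is a direct computation.
\<close>

section \<open>Mean absorption time of a descending process\<close>

lemma less_INF_enat_iff:
  fixes b :: "nat \<Rightarrow> nat"
  assumes "antimono b"
  shows "enat t < (INF s\<in>{s. b s = 0}. enat s) \<longleftrightarrow> 0 < b t"
proof -
  have "(INF s\<in>{s. b s = 0}. enat s) \<le> enat t \<longleftrightarrow> b t = 0"
  proof
    assume le: "(INF s\<in>{s. b s = 0}. enat s) \<le> enat t"
    then have "(INF s\<in>{s. b s = 0}. enat s) < enat (Suc t)"
      by (meson enat_ord_simps(2) lessI order_le_less_trans)
    then obtain s where "b s = 0" "s \<le> t"
      by (auto simp: INF_less_iff)
    then show "b t = 0"
      using antimonoD[OF assms, of s t] by simp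
  qed (simp add: INF_lower)
  then show ?thesis
    by (metis gr0I not_le less_irrefl)
qed

text \<open>
  The mean time is the sum over \<open>t\<close> of \<open>P (Y t > 0)\<close>, that is, the sum over the levels \<open>k \<ge> 1\<close> of the
  mean number of visits to \<open>k\<close>. Since the process starts at \<open>N\<close> and never skips a level, the mass
  that leaves \<open>{k..}\<close> must do so from \<open>k\<close>, at rate \<open>p k\<close>. Until time \<open>T\<close> the mass that has left is
  \<open>1 - P (Y T \<ge> k)\<close>, which bounds the number of visits to each level; so every \<open>P (Y t = k)\<close> tends to
  \<open>0\<close>, the whole mass leaves in the end, and the mean number of visits is \<open>1 / p k\<close>.
\<close>

lemma (in prob_space) nn_integral_descent_time:
  fixes Y :: "nat \<Rightarrow> 'a \<Rightarrow> nat" and N :: nat and p :: "nat \<Rightarrow> real"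
  assumes rv [measurable]: "\<And>t. random_variable (count_space UNIV) (Y t)"
    and start: "\<And>\<omega>. \<omega> \<in> space M \<Longrightarrow> Y 0 \<omega> = N"
    and step: "\<And>t \<omega>. \<omega> \<in> space M \<Longrightarrow> Y (Suc t) \<omega> = Y t \<omega> \<or> Suc (Y (Suc t) \<omega>) = Y t \<omega>"
    and pos: "\<And>k. k \<in> {1..N} \<Longrightarrow> 0 < p k"
    and rate: "\<And>t k. k \<in> {1..N} \<Longrightarrow>
      \<P>(\<omega> in M. Y t \<omega> = k \<and> Y (Suc t) \<omega> < k) = p k * \<P>(\<omega> in M. Y t \<omega> = k)"
  shows "(\<integral>\<^sup>+ \<omega>. ennreal_of_enat (INF t\<in>{t. Y t \<omega> = 0}. enat t) \<partial>M) = ennreal (\<Sum>k=1..N. 1 / p k)"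
proof -
  define q where "q k t = \<P>(\<omega> in M. Y t \<omega> = k)" for k t
  define F where "F k t = \<P>(\<omega> in M. k \<le> Y t \<omega>)" for k t
  have anti: "antimono (\<lambda>t. Y t \<omega>)" if "\<omega> \<in> space M" for \<omega>
    using step[OF that] by (intro decseq_SucI) (metis Suc_n_not_le_n nle_le)
  have Y_le: "Y t \<omega> \<le> N" if "\<omega> \<in> space M" for t \<omega>
    using antimonoD[OF anti[OF that], of 0 t] start[OF that] by simp
  have q_nonneg: "0 \<le> q k t" for k t
    by (simp add: q_def)
  (* As Y moves down by at most one, leaving {k..} means stepping down from k. *)
  have flux: "F k t - F k (Suc t) = p k * q k t" if "k \<in> {1..N}" for k t
  proof -
    have "{\<omega> \<in> space M. k \<le> Y t \<omega>} =
        {\<omega> \<in> space M. k \<le> Y (Suc t) \<omega>} \<union> {\<omega> \<in> space M. Y t \<omega> = k \<and> Y (Suc t) \<omega> < k}"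
      using step[of _ t] by force
    moreover have "{\<omega> \<in> space M. k \<le> Y (Suc t) \<omega>} \<inter> {\<omega> \<in> space M. Y t \<omega> = k \<and> Y (Suc t) \<omega> < k} = {}"
      by auto
    ultimately have "F k t = F k (Suc t) + \<P>(\<omega> in M. Y t \<omega> = k \<and> Y (Suc t) \<omega> < k)"
      by (simp add: F_def finite_measure_Union)
    then show ?thesis
      using rate[OF that] by (simp add: q_def)
  qed
  have F_eq: "F k t = (\<Sum>j=k..N. q j t)" for k t
  proof -
    have "{\<omega> \<in> space M. k \<le> Y t \<omega>} = (\<Union>j\<in>{k..N}. {\<omega> \<in> space M. Y t \<omega> = j})"
      using Y_le by auto
    then show ?thesis
      by (simp add: F_def q_def)
        (intro finite_measure_finite_Union, auto simp: disjoint_family_on_def)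
  qed
  have F_0: "F k 0 = 1" if "k \<in> {1..N}" for k
  proof -
    have "{\<omega> \<in> space M. k \<le> Y 0 \<omega>} = space M"
      using start that by auto
    then show ?thesis
      by (simp add: F_def prob_space)
  qed
  have partial: "(\<Sum>t<T. q k t) = (1 - F k T) / p k" if k: "k \<in> {1..N}" for k T
  proof -
    have "p k * (\<Sum>t<T. q k t) = (\<Sum>t<T. F k t - F k (Suc t))"
      using flux[OF k] by (simp add: sum_distrib_left)
    also have "\<dots> = 1 - F k T"
      using F_0[OF k] sum_lessThan_telescope'[of "F k" T] by simp
    finally show ?thesis
      using pos[OF k] by (simp add: field_simps)
  qed
  have q_lim: "q k \<longlonglongrightarrow> 0" if k: "k \<in> {1..N}" for k
  proof (rule summable_LIMSEQ_zero, rule summableI_nonneg_bounded)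
    show "(\<Sum>t<T. q k t) \<le> 1 / p k" for T
      using pos[OF k] by (simp add: partial[OF k] F_def divide_right_mono)
  qed (rule q_nonneg)
  have q_sums: "q k sums (1 / p k)" if k: "k \<in> {1..N}" for k
  proof -
    have "(\<lambda>T. F k T) \<longlonglongrightarrow> (\<Sum>j=k..N. 0)"
      unfolding F_eq using k by (intro tendsto_sum q_lim) auto
    then have "(\<lambda>T. (1 - F k T) / p k) \<longlonglongrightarrow> (1 - 0) / p k"
      using pos[OF k] by (intro tendsto_intros) auto
    then show ?thesis
      by (simp add: sums_def partial[OF k])
  qed
  have F_sums: "F 1 sums (\<Sum>k=1..N. 1 / p k)"
    unfolding F_eq by (intro sums_sum q_sums)
  have less_iff: "enat t < (INF s\<in>{s. Y s \<omega> = 0}. enat s) \<longleftrightarrow> 1 \<le> Y t \<omega>"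
    if "\<omega> \<in> space M" for t \<omega>
    using less_INF_enat_iff[OF anti[OF that]] by auto
  have "(\<integral>\<^sup>+ \<omega>. ennreal_of_enat (INF t\<in>{t. Y t \<omega> = 0}. enat t) \<partial>M) =
      (\<Sum>t. emeasure M {\<omega> \<in> space M. enat t < (INF s\<in>{s. Y s \<omega> = 0}. enat s)})"
  proof (rule nn_integral_enat_function)
    (* An infimum over a fixed countable index set is covered by the measurability rules. *)
    have "(INF t\<in>{t. Y t \<omega> = 0}. enat t) = (INF t. if Y t \<omega> = 0 then enat t else \<infinity>)" for \<omega>
    proof (rule antisym)
      show "(INF t\<in>{t. Y t \<omega> = 0}. enat t) \<le> (INF t. if Y t \<omega> = 0 then enat t else \<infinity>)"
        by (rule INF_greatest) (simp add: INF_lower)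
      show "(INF t. if Y t \<omega> = 0 then enat t else \<infinity>) \<le> (INF t\<in>{t. Y t \<omega> = 0}. enat t)"
      proof (rule INF_greatest)
        fix t assume "t \<in> {t. Y t \<omega> = 0}"
        then show "(INF t. if Y t \<omega> = 0 then enat t else \<infinity>) \<le> enat t"
          by (intro INF_lower2[of t]) simp_all
      qed
    qed
    then show "(\<lambda>\<omega>. INF t\<in>{t. Y t \<omega> = 0}. enat t) \<in> measurable M (count_space UNIV)"
      by (simp only:) measurable
  qed
  also have "\<dots> = (\<Sum>t. ennreal (F 1 t))"
  proof (rule suminf_cong)
    fix t
    have "{\<omega> \<in> space M. enat t < (INF s\<in>{s. Y s \<omega> = 0}. enat s)} = {\<omega> \<in> space M. 1 \<le> Y t \<omega>}"
      using less_iff by blast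
    then show "emeasure M {\<omega> \<in> space M. enat t < (INF s\<in>{s. Y s \<omega> = 0}. enat s)} = ennreal (F 1 t)"
      by (simp add: F_def emeasure_eq_measure)
  qed
  also have "\<dots> = ennreal (\<Sum>k=1..N. 1 / p k)"
    by (intro suminf_ennreal_eq[OF _ F_sums]) (simp add: F_def)
  finally show ?thesis .
qed

section \<open>The harmonic sum\<close>

text \<open>
  The right-hand side is the integral of \<open>1 / x\<close> over \<open>{a - h..a + h}\<close>, and convexity puts the mean of
  \<open>1 / x\<close> over an interval above the value at its midpoint.
\<close>

lemma mean_inverse_le_ln:
  fixes a h :: real
  assumes "0 < h" "h < a"
  shows "2 * h / a \<le> ln ((a + h) / (a - h))"
  using ln_inverse_approx_ge[of "a - h" "a + h"] assms by (simp add: ln_div)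

lemma harm_pred: "1 \<le> i \<Longrightarrow> harm i = (harm (i - 1) + 1 / real i :: real)"
  using harm_Suc[of "i - 1"] by (simp add: inverse_eq_divide)

lemma harm_diff_ge: "1 \<le> i \<Longrightarrow> i \<le> n \<Longrightarrow> 1 / real i \<le> harm n - harm (i - 1)"
  using harm_mono[of i n, where 'a = real] harm_pred[of i] by linarith

text \<open>
  Splitting \<open>3 = (4 / 3) (3 / 2) (3 / 2)\<close> keeps the midpoint rule accurate enough: it gives
  \<open>2 / 7 + 4 / 5\<close>, just above \<open>13 / 12\<close>.
\<close>

lemma ln_3_ge: "13 / 12 \<le> ln (3 :: real)"
proof -
  have "ln (3::real) = ln (4 / 3) + 2 * ln (3 / 2)"
    using ln_realpow[of "2::real" 2] by (simp add: ln_div)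
  then show ?thesis
    using ln_inverse_approx_ge[of 1 "4 / 3"] ln_inverse_approx_ge[of 1 "3 / 2"] by simp
qed

text \<open>
  The difference \<open>H n - ln n\<close> is decreasing, so \<open>n = 3\<close> is the worst case; there \<open>H 3 = 11 / 6\<close>.
\<close>

lemma harm_le_ln:
  assumes "3 \<le> n"
  shows "harm n \<le> ln (real n) + 3 / 4"
proof -
  have "harm n - ln (real n) \<le> harm 3 - ln (real 3)"
    using decseqD[OF decseq_harm_diff_ln, of 2 "n - 1"] assms by (simp add: numeral_3_eq_3)
  also have "\<dots> \<le> 3 / 4"
    using ln_3_ge by (simp add: harm_expand)
  finally show ?thesis by simp
qed

text \<open>
  With \<open>a i = H n - H (i - 1)\<close>, the right-hand side is the integral of \<open>1 / x\<close> from the lower end of the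
  interval around \<open>a m\<close> to the upper end of the interval around \<open>a 2 = H n - 1\<close>, where the radius of
  the interval around \<open>a i\<close> is \<open>1 / (2 i)\<close>. The upper end \<open>H n - 3 / 4\<close> matters: the cruder
  telescoping value \<open>H n - 1 / 2\<close> exceeds \<open>ln n\<close> for every \<open>n\<close>, which would cost a term of order
  \<open>n / ln n\<close>.
\<close>

lemma sum_inverse_harm_diff_le:
  assumes "2 \<le> m" "m \<le> n"
  shows "(\<Sum>i=2..m. 1 / (real i * (harm n - harm (i - 1)))) \<le>
    ln (harm n - 3 / 4) - ln (harm n - harm (m - 1) - 1 / (2 * real m))"
  using assms
proof (induction m rule: nat_induct_at_least)
  case base
  show ?case
    using mean_inverse_le_ln[of "1 / 4" "harm n - 1"] harm_mono[of 2 n, where 'a = real] base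
    by (simp add: harm_expand ln_div)
next
  case (Suc m)
  define a :: real where "a = harm n - harm m"
  define h where "h = 1 / (2 * real (Suc m))"
  have pos: "0 < h" "h < a"
    using harm_diff_ge[of "Suc m" n] Suc.prems by (auto simp: a_def h_def field_simps)
  (* The interval around a = a (Suc m) ends before the interval around a m begins. *)
  have shift: "a + h \<le> harm n - harm (m - 1) - 1 / (2 * real m)"
  proof -
    have "h \<le> 1 / (2 * real m)"
      unfolding h_def using Suc.hyps by (intro divide_left_mono) auto
    moreover have "harm m = (harm (m - 1) + 2 * (1 / (2 * real m)) :: real)"
      using harm_pred[of m] Suc.hyps by simp
    ultimately show ?thesis
      unfolding a_def by linarith
  qed
  have "1 / (real (Suc m) * a) = 2 * h / a"
    by (simp add: h_def del: of_nat_Suc)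
  also have "\<dots> \<le> ln (a + h) - ln (a - h)"
    using mean_inverse_le_ln[OF pos] pos by (simp add: ln_div)
  also have "\<dots> \<le> ln (harm n - harm (m - 1) - 1 / (2 * real m)) - ln (a - h)"
    using shift pos by simp
  finally show ?case
    using Suc by (simp add: a_def h_def)
qed

lemma sum_inverse_harm_diff_le_ln:
  assumes "2 \<le> n"
  shows "(\<Sum>i=2..n. real n / (real i * (harm n - harm (i - 1))))
    \<le> real n * ln (real n) + real n * ln (ln (real n)) + real n * ln 2 + 1"
proof (cases "n = 2")
  case True
  (* ln (ln 2) is negative; ln x \<le> x - 1 at x = 1 / ln 2 keeps it above -1/2. *)
  have "ln (1 / ln 2) \<le> 1 / ln 2 - (1::real)"
    by (rule ln_le_minus_one) simp
  then have "- ln (ln 2) \<le> 1 / ln 2 - (1::real)"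
    by (simp add: ln_div)
  moreover have "1 / ln 2 \<le> (3 / 2 :: real)"
    using ln2_ge_two_thirds by (simp add: field_simps)
  ultimately show ?thesis
    using True ln2_ge_two_thirds by (simp add: harm_expand)
next
  case False
  then have n: "3 \<le> n" using assms by simp
  have "harm n - harm (n - 1) - 1 / (2 * real n) = 1 / (2 * real n)"
    using harm_pred[of n] n by (simp add: field_simps)
  then have "(\<Sum>i=2..n. 1 / (real i * (harm n - harm (i - 1)))) \<le>
      ln (harm n - 3 / 4) - ln (1 / (2 * real n))"
    using sum_inverse_harm_diff_le[of n n] n by simp
  also have "\<dots> = ln (harm n - 3 / 4) + ln 2 + ln (real n)"
    using n by (simp add: ln_div ln_mult)
  also have "ln (harm n - 3 / 4) \<le> ln (ln (real n))"
    using harm_le_ln[OF n] harm_mono[of 1 n, where 'a = real] n by (simp add: harm_expand)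
  finally have "real n * (\<Sum>i=2..n. 1 / (real i * (harm n - harm (i - 1)))) \<le>
      real n * (ln (ln (real n)) + ln 2 + ln (real n))"
    by (intro mult_left_mono) auto
  then show ?thesis
    by (simp add: sum_distrib_left algebra_simps)
qed

section \<open>The bookmark height as a function of the choices\<close>

text \<open>
  Given \<open>I = i \<le> k\<close>, the position \<open>J\<close> is uniform on the \<open>n + 1 - i\<close> values of \<open>{i..n}\<close>, of which
  \<open>n + 1 - k\<close> are at least \<open>k\<close>. Averaging \<open>(n + 1 - k) / (n + 1 - i)\<close> over \<open>i\<close> sums the reciprocals
  from \<open>n + 1 - k\<close> to \<open>n\<close>.
\<close>

lemma prob_below_choice_crosses:
  assumes "1 \<le> k" "k \<le> n"
  shows "measure_pmf.prob (below_choice_pmf n) {(i, j). i \<le> k \<and> k \<le> j} =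
    real (n + 1 - k) * (harm n - harm (n - k)) / real n"
proof -
  define C where "C = {(i, j). i \<le> k \<and> k \<le> j}"
  have inner: "emeasure (map_pmf (Pair i) (pmf_of_set {i..n})) C =
      ennreal (if i \<le> k then real (n + 1 - k) / real (n + 1 - i) else 0)" if "i \<in> {1..n}" for i
  proof -
    have "{i..n} \<inter> Pair i -` C = (if i \<le> k then {k..n} else {})"
      by (auto simp: C_def)
    then show ?thesis
      using that assms by (simp add: emeasure_pmf_of_set divide_ennreal Suc_diff_le)
  qed
  have harm_sum: "(\<Sum>i=1..k. 1 / real (n + 1 - i)) = harm n - harm (n - k)"
    using assms(2)
  proof (induction k)
    case (Suc k)
    then have "n - k = Suc (n - Suc k)" by simp
    then show ?case
      using Suc harm_Suc[of "n - Suc k", where 'a = real]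
      by (simp add: inverse_eq_divide)
  qed simp
  have "emeasure (below_choice_pmf n) C =
      ennreal ((\<Sum>i=1..n. if i \<le> k then real (n + 1 - k) / real (n + 1 - i) else 0) / real n)"
    (is "_ = ennreal (?S / _)")
  proof -
    have "0 \<le> ?S"
      by (intro sum_nonneg) simp
    moreover have "emeasure (below_choice_pmf n) C = ennreal ?S / of_nat n"
      using assms by (simp add: below_choice_pmf_def nn_integral_pmf_of_set inner
          del: emeasure_map_pmf of_nat_diff)
    ultimately show ?thesis
      using assms by (simp only: ennreal_of_nat_eq_real_of_nat) (subst divide_ennreal, auto)
  qed
  also have "(\<Sum>i=1..n. if i \<le> k then real (n + 1 - k) / real (n + 1 - i) else 0) =
      (\<Sum>i=1..k. real (n + 1 - k) * (1 / real (n + 1 - i)))"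
    using assms by (intro sum.mono_neutral_cong_right) auto
  finally show ?thesis
    unfolding sum_distrib_left[symmetric] harm_sum
    using harm_mono[of "n - k" n, where 'a = real]
    by (simp add: measure_def C_def)
qed

lemma below_choice_valid:
  "x \<in> set_pmf (below_choice_pmf n) \<Longrightarrow> 1 \<le> n \<Longrightarrow> 1 \<le> fst x \<and> fst x \<le> snd x \<and> snd x \<le> n"
  by (auto simp: below_choice_pmf_def)

text \<open>
  The recursion of the bookmark height, run on an arbitrary sequence of choices. On valid choices it
  agrees with the deck model; on the other sequences it still descends by at most one per
  step, and at every time it is visibly a function of finitely many choices.
\<close>

primrec bookmark_height :: "nat \<Rightarrow> (nat \<Rightarrow> nat \<times> nat) \<Rightarrow> nat \<Rightarrow> nat" where
  "bookmark_height n x 0 = n - 1"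
| "bookmark_height n x (Suc t) =
     (let b = bookmark_height n x t in
      if fst (x (Suc t)) \<le> b \<and> b \<le> snd (x (Suc t)) then b - 1 else b)"

lemma cards_above_bookmark_eq_height:
  assumes "d \<noteq> []" "\<And>s. 1 \<le> s \<Longrightarrow> 1 \<le> I s \<and> I s \<le> J s \<and> J s \<le> length d"
  shows "cards_above_bookmark I J d t = bookmark_height (length d) (\<lambda>s. (I s, J s)) t"
proof (induction t)
  case (Suc t)
  then show ?case
    using cards_above_bookmark_Suc[OF assms(1), of t I J] assms(2) by (simp add: Let_def)
qed (simp add: cards_above_bookmark_0)

lemma bookmark_height_cong:
  "(\<And>s. s \<in> {1..t} \<Longrightarrow> x s = y s) \<Longrightarrow> bookmark_height n x t = bookmark_height n y t"
  by (induction t) (auto simp: Let_def)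

lemma bookmark_height_measurable:
  assumes "{1..t} \<subseteq> A"
  shows "(\<lambda>x. bookmark_height n x t) \<in> measurable (PiM A (\<lambda>_. count_space UNIV)) (count_space UNIV)"
  using assms
proof (induction t)
  case (Suc t)
  let ?P = "PiM A (\<lambda>_. count_space (UNIV :: (nat \<times> nat) set))"
  have [measurable]: "(\<lambda>x. bookmark_height n x t) \<in> measurable ?P (count_space UNIV)"
    using Suc.prems by (intro Suc.IH) auto
  have [measurable]: "(\<lambda>x. x (Suc t)) \<in> measurable ?P (count_space UNIV)"
    using Suc.prems by (intro measurable_component_singleton) auto
  show ?case
    by (simp add: Let_def)
qed simp

text \<open>
  The height at time \<open>t\<close> depends only on the choices at times \<open>1, \<dots>, t\<close>, and at height \<open>k\<close> the descent
  is decided by the choice at time \<open>t + 1\<close> alone, so the two probabilities multiply.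
\<close>

lemma (in prob_space) bookmark_height_rate:
  fixes X :: "nat \<Rightarrow> 'a \<Rightarrow> nat \<times> nat" and n :: nat
  defines "Y \<equiv> \<lambda>t \<omega>. bookmark_height n (\<lambda>s. X s \<omega>) t"
  assumes indep: "indep_vars (\<lambda>_. count_space UNIV) X {1..}"
    and distr: "\<And>t. 1 \<le> t \<Longrightarrow> distr M (count_space UNIV) (X t) = measure_pmf Q"
    and k: "1 \<le> k"
  shows "\<P>(\<omega> in M. Y t \<omega> = k \<and> Y (Suc t) \<omega> < k) =
    measure_pmf.prob Q {(i, j). i \<le> k \<and> k \<le> j} * \<P>(\<omega> in M. Y t \<omega> = k)"
proof -
  let ?C = "{(i, j). i \<le> k \<and> k \<le> j}"
  let ?N = "\<lambda>_::nat. count_space (UNIV :: (nat \<times> nat) set)"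
  (* Independence of two random variables needs a common value type, so the next choice is
     replaced by a natural number that tells whether it crosses level k. *)
  define Z :: "'a \<Rightarrow> nat" where "Z = (\<lambda>\<omega>. if X (Suc t) \<omega> \<in> ?C then 1 else 0)"
  have X [measurable]: "random_variable (count_space UNIV) (X (Suc t))"
    using indep by (simp add: indep_vars_def)
  have "indep_var (PiM {1..t} ?N) (\<lambda>\<omega>. restrict (\<lambda>i. X i \<omega>) {1..t})
      (PiM {Suc t} ?N) (\<lambda>\<omega>. restrict (\<lambda>i. X i \<omega>) {Suc t})"
    by (rule indep_var_restrict[OF indep]) auto
  then have "indep_var (count_space UNIV)
      ((\<lambda>x. bookmark_height n x t) \<circ> (\<lambda>\<omega>. restrict (\<lambda>i. X i \<omega>) {1..t}))
      (count_space UNIV) ((\<lambda>x. if x (Suc t) \<in> ?C then 1 else 0) \<circ> (\<lambda>\<omega>. restrict (\<lambda>i. X i \<omega>) {Suc t}))"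
  proof (rule indep_var_compose)
    have "(\<lambda>x. x (Suc t)) \<in> measurable (PiM {Suc t} ?N) (count_space UNIV)"
      by simp
    then show "(\<lambda>x. if x (Suc t) \<in> ?C then 1 else 0) \<in> measurable (PiM {Suc t} ?N) (count_space UNIV)"
      by (rule measurable_compose[where g = "\<lambda>z. if z \<in> ?C then 1 else 0"]) simp
  qed (simp add: bookmark_height_measurable)
  moreover have "(\<lambda>x. bookmark_height n x t) \<circ> (\<lambda>\<omega>. restrict (\<lambda>i. X i \<omega>) {1..t}) = Y t"
    by (rule ext) (auto simp: Y_def intro!: bookmark_height_cong)
  moreover have "(\<lambda>x. if x (Suc t) \<in> ?C then 1 else 0) \<circ> (\<lambda>\<omega>. restrict (\<lambda>i. X i \<omega>) {Suc t}) = Z"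
    by (auto simp: Z_def)
  ultimately have "indep_var (count_space UNIV) (Y t) (count_space UNIV) Z"
    by simp
  then have "prob ((\<lambda>\<omega>. (Y t \<omega>, Z \<omega>)) -` ({k} \<times> {1}) \<inter> space M) =
      prob (Y t -` {k} \<inter> space M) * prob (Z -` {1} \<inter> space M)"
    by (rule indep_varD) auto
  moreover have "prob (Z -` {1} \<inter> space M) = measure_pmf.prob Q ?C"
  proof -
    have "Z -` {1} \<inter> space M = X (Suc t) -` ?C \<inter> space M"
      by (auto simp: Z_def split: if_splits)
    then show ?thesis
      using measure_distr[OF X, of ?C] distr[of "Suc t"] by simp
  qed
  moreover have "(\<lambda>\<omega>. (Y t \<omega>, Z \<omega>)) -` ({k} \<times> {1}) \<inter> space M =
      {\<omega> \<in> space M. Y t \<omega> = k \<and> Y (Suc t) \<omega> < k}"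
  proof -
    have "Y t \<omega> = k \<and> Z \<omega> = 1 \<longleftrightarrow> Y t \<omega> = k \<and> Y (Suc t) \<omega> < k" for \<omega>
    proof (cases "Y t \<omega> = k")
      case True
      have "Y (Suc t) \<omega> =
          (if fst (X (Suc t) \<omega>) \<le> Y t \<omega> \<and> Y t \<omega> \<le> snd (X (Suc t) \<omega>) then Y t \<omega> - 1 else Y t \<omega>)"
        by (simp add: Y_def Let_def)
      then show ?thesis
        using k True by (simp add: Z_def mem_Times_iff)
    qed simp
    then show ?thesis
      by auto
  qed
  moreover have "Y t -` {k} \<inter> space M = {\<omega> \<in> space M. Y t \<omega> = k}"
    by auto
  ultimately show ?thesis
    by simp
qed

section \<open>The expected strong stationary time\<close>

theorem theorem15p2:
  fixes M :: "'a measure" and I J :: "nat \<Rightarrow> 'a \<Rightarrow> nat" and d :: "'c list" and n :: nat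
  assumes n: "n \<ge> 2"
    and deck: "length d = n" "distinct d"
    and prob: "prob_space M"
    and indep: "prob_space.indep_vars M (\<lambda>_. count_space UNIV) (\<lambda>t \<omega>. (I t \<omega>, J t \<omega>)) {1..}"
    and choice: "\<And>t. t \<ge> 1 \<Longrightarrow>
      distr M (count_space UNIV) (\<lambda>\<omega>. (I t \<omega>, J t \<omega>)) = measure_pmf (below_choice_pmf n)"
  shows "(\<integral>\<^sup>+ \<omega>. ennreal_of_enat (bookmark_time (\<lambda>t. I t \<omega>) (\<lambda>t. J t \<omega>) d) \<partial>M) =
           ennreal (\<Sum>i=2..n. real n / (real i * (harm n - harm (i - 1))))
       \<and> (\<Sum>i=2..n. real n / (real i * (harm n - harm (i - 1))))
           \<le> real n * ln (real n) + real n * ln (ln (real n)) + real n * ln 2 + 1"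
proof
  interpret prob_space M by (rule prob)
  define X where "X = (\<lambda>t \<omega>. (I t \<omega>, J t \<omega>))"
  define Y where "Y = (\<lambda>t \<omega>. bookmark_height n (\<lambda>s. X s \<omega>) t)"
  define p where "p k = measure_pmf.prob (below_choice_pmf n) {(i, j). i \<le> k \<and> k \<le> j}" for k
  have X: "random_variable (count_space UNIV) (X t)" if "1 \<le> t" for t
    using indep that by (simp add: X_def indep_vars_def)
  have X_distr: "distr M (count_space UNIV) (X t) = measure_pmf (below_choice_pmf n)" if "1 \<le> t" for t
    using choice[OF that] by (simp add: X_def)
  have p_eq: "p k = real (n + 1 - k) * (harm n - harm (n - k)) / real n" if "k \<in> {1..n - 1}" for k
    unfolding p_def using that n by (intro prob_below_choice_crosses) auto
  have p_pos: "0 < p k" if "k \<in> {1..n - 1}" for k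
  proof -
    have idx: "n + 1 - k - 1 = n - k" "1 \<le> n + 1 - k" "n + 1 - k \<le> n"
      using that by auto
    have "0 < 1 / real (n + 1 - k)"
      using idx by (simp del: of_nat_diff)
    also have "\<dots> \<le> harm n - harm (n - k)"
      using idx harm_diff_ge[of "n + 1 - k" n] by (simp only:)
    finally have "0 < harm n - (harm (n - k) :: real)" .
    then show ?thesis
      unfolding p_eq[OF that] using idx n by (intro divide_pos_pos mult_pos_pos) (simp_all del: of_nat_diff)
  qed
  (* The hypotheses fix the choices only in distribution, so they are valid almost surely. *)
  have valid: "AE \<omega> in M. \<forall>t\<in>{1..}. 1 \<le> I t \<omega> \<and> I t \<omega> \<le> J t \<omega> \<and> J t \<omega> \<le> n"
  proof (intro AE_ball_countable[THEN iffD2] ballI)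
    fix t :: nat assume t: "t \<in> {1..}"
    have "AE x in distr M (count_space UNIV) (X t). 1 \<le> fst x \<and> fst x \<le> snd x \<and> snd x \<le> n"
      using n t by (subst X_distr) (auto simp: AE_measure_pmf_iff dest!: below_choice_valid)
    from AE_distrD[OF X this] t show "AE \<omega> in M. 1 \<le> I t \<omega> \<and> I t \<omega> \<le> J t \<omega> \<and> J t \<omega> \<le> n"
      by (simp only: X_def fst_conv snd_conv atLeast_iff)
  qed simp
  have "(\<integral>\<^sup>+ \<omega>. ennreal_of_enat (bookmark_time (\<lambda>t. I t \<omega>) (\<lambda>t. J t \<omega>) d) \<partial>M) =
      (\<integral>\<^sup>+ \<omega>. ennreal_of_enat (INF t\<in>{t. Y t \<omega> = 0}. enat t) \<partial>M)"
  proof (rule nn_integral_cong_AE, use valid in eventually_elim)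
    fix \<omega> assume "\<forall>t\<in>{1..}. 1 \<le> I t \<omega> \<and> I t \<omega> \<le> J t \<omega> \<and> J t \<omega> \<le> n"
    moreover have "d \<noteq> []"
      using deck n by auto
    ultimately have "cards_above_bookmark (\<lambda>t. I t \<omega>) (\<lambda>t. J t \<omega>) d t = Y t \<omega>" for t
      using deck cards_above_bookmark_eq_height[of d "\<lambda>t. I t \<omega>" "\<lambda>t. J t \<omega>" t]
      by (auto simp: Y_def X_def)
    then show "ennreal_of_enat (bookmark_time (\<lambda>t. I t \<omega>) (\<lambda>t. J t \<omega>) d) =
        ennreal_of_enat (INF t\<in>{t. Y t \<omega> = 0}. enat t)"
      by (simp add: bookmark_time_def)
  qed
  also have "\<dots> = ennreal (\<Sum>k=1..n - 1. 1 / p k)"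
  proof (rule nn_integral_descent_time)
    show "random_variable (count_space UNIV) (Y t)" for t
    proof -
      have "(\<lambda>\<omega>. restrict (\<lambda>s. X s \<omega>) {1..t}) \<in> measurable M (PiM {1..t} (\<lambda>_. count_space UNIV))"
        by (intro measurable_restrict X) auto
      then have "(\<lambda>\<omega>. bookmark_height n (restrict (\<lambda>s. X s \<omega>) {1..t}) t) \<in> measurable M (count_space UNIV)"
        by (rule measurable_compose) (rule bookmark_height_measurable[OF order_refl])
      also have "(\<lambda>\<omega>. bookmark_height n (restrict (\<lambda>s. X s \<omega>) {1..t}) t) = Y t"
        unfolding Y_def by (intro ext bookmark_height_cong) simp
      finally show ?thesis .
    qed
    show "\<P>(\<omega> in M. Y t \<omega> = k \<and> Y (Suc t) \<omega> < k) = p k * \<P>(\<omega> in M. Y t \<omega> = k)"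
      if "k \<in> {1..n - 1}" for t k
      unfolding p_def Y_def by (rule bookmark_height_rate) (use that indep X_distr in \<open>simp_all add: X_def\<close>)
  qed (use p_pos in \<open>auto simp: Y_def Let_def\<close>)
  also have "(\<Sum>k=1..n - 1. 1 / p k) = (\<Sum>i=2..n. real n / (real i * (harm n - harm (i - 1))))"
    by (rule sum.reindex_bij_witness[of _ "\<lambda>i. n + 1 - i" "\<lambda>k. n + 1 - k"]) (auto simp: p_eq)
  finally show "(\<integral>\<^sup>+ \<omega>. ennreal_of_enat (bookmark_time (\<lambda>t. I t \<omega>) (\<lambda>t. J t \<omega>) d) \<partial>M) =
      ennreal (\<Sum>i=2..n. real n / (real i * (harm n - harm (i - 1))))" .
  show "(\<Sum>i=2..n. real n / (real i * (harm n - harm (i - 1))))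
      \<le> real n * ln (real n) + real n * ln (ln (real n)) + real n * ln 2 + 1"
    using n by (rule sum_inverse_harm_diff_le_ln)
qed

end
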